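(* Let $X$ be a real random variable with finite law $x_1<\cdots<x_n$, $p_i=\mathbb P(X=x_i)>0$, $\sum_{i=1}^n p_i=1$, $n\ge 2$, and mean $\mu=\mathbb E X$. Suppose that $\mu=x_k$ for some $k$ and $$\mathbb P(X<\mu)=\mathbb P(X>\mu)=q>0 .$$ Then the cuts immediately below and immediately above $\mu$ (the cuts after $x_{k-1}$ and after $x_k$) have the same gain, $B_{k-1}=B_k$. If the signal $D_i:=R_i^2-L_i^2$ $(1\le i\le n)$ is nonincreasing in $i$, both cuts are globally optimal; if the signal is strictly decreasing, these are the only optimal cuts.
   Context: Put $P_i:=\sum_{j\le i}p_j$, $P_0:=0$, and $T_i:=\sum_{j\ge i}p_j=1-P_{i-1}$. For $1\le i<n$ the optimized squared risk at the cut after $x_i$ (the partition $\{X\le x_i\}\mid\{X>x_i\}$) is $$W_i:=\min_{a,b\in\mathbb R}\Big\{\sum_{j\le i}p_j(x_j-a)^2+\sum_{j>i}p_j(x_j-b)^2\Big\},$$ and its gain is $B_i:=\operatorname{Var}(X)-W_i$. The cut after $x_i$ is globally optimal if $W_i=\min_{1\le j<n}W_j$. For $1\le i<n$ set $A_i:=\sum_{j>i}p_j(x_j-x_i)$ and $R_i:=A_i/\sqrt{T_iT_{i+1}}$; for $1<i\le n$ set $C_i:=\sum_{j<i}p_j(x_i-x_j)$ and $L_i:=C_i/\sqrt{P_{i-1}P_i}$; and $L_1:=0$, $R_n:=0$. *)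

theory Defs
  imports "HOL-Probability.Probability"
begin

text \<open>
  Throughout, a finite law is given by its number \<open>n\<close> of atoms, its weights \<open>p\<close> and its
  atoms \<open>x\<close>; only the values of \<open>p\<close> and \<open>x\<close> at the indices \<open>1, \<dots>, n\<close> matter.
\<close>

definition finite_law ::
  "'a measure \<Rightarrow> ('a \<Rightarrow> real) \<Rightarrow> nat \<Rightarrow> (nat \<Rightarrow> real) \<Rightarrow> (nat \<Rightarrow> real) \<Rightarrow> bool" where
  "finite_law M X n p x \<longleftrightarrow>
     prob_space M \<and> X \<in> borel_measurable M \<and>
     strict_mono_on {1..n} x \<and>
     (\<forall>i\<in>{1..n}. p i = measure M {\<omega> \<in> space M. X \<omega> = x i} \<and> p i > 0) \<and>
     (\<Sum>i=1..n. p i) = 1"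

definition cumP :: "(nat \<Rightarrow> real) \<Rightarrow> nat \<Rightarrow> real" where
  "cumP p i = (\<Sum>j=1..i. p j)"

definition tailT :: "nat \<Rightarrow> (nat \<Rightarrow> real) \<Rightarrow> nat \<Rightarrow> real" where
  "tailT n p i = (\<Sum>j=i..n. p j)"

definition split_risk ::
  "nat \<Rightarrow> (nat \<Rightarrow> real) \<Rightarrow> (nat \<Rightarrow> real) \<Rightarrow> nat \<Rightarrow> real \<Rightarrow> real \<Rightarrow> real" where
  "split_risk n p x i a b =
     (\<Sum>j=1..i. p j * (x j - a)\<^sup>2) + (\<Sum>j\<in>{i<..n}. p j * (x j - b)\<^sup>2)"

text \<open>
  The optimized risk is a minimum, expressed by \<open>LEAST\<close>; \<open>optimal_risk_attained\<close> below
  shows that it is attained for every cut of a law with positive weights.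
\<close>

definition optimal_risk :: "nat \<Rightarrow> (nat \<Rightarrow> real) \<Rightarrow> (nat \<Rightarrow> real) \<Rightarrow> nat \<Rightarrow> real" where
  "optimal_risk n p x i = (LEAST w. \<exists>a b. w = split_risk n p x i a b)"

definition gain ::
  "'a measure \<Rightarrow> ('a \<Rightarrow> real) \<Rightarrow> nat \<Rightarrow> (nat \<Rightarrow> real) \<Rightarrow> (nat \<Rightarrow> real) \<Rightarrow> nat \<Rightarrow> real" where
  "gain M X n p x i = prob_space.variance M X - optimal_risk n p x i"

definition globally_optimal_cut ::
  "nat \<Rightarrow> (nat \<Rightarrow> real) \<Rightarrow> (nat \<Rightarrow> real) \<Rightarrow> nat \<Rightarrow> bool" where
  "globally_optimal_cut n p x i \<longleftrightarrow>
     i \<in> {1..<n} \<and> optimal_risk n p x i = Min (optimal_risk n p x ` {1..<n})"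

definition upperA :: "nat \<Rightarrow> (nat \<Rightarrow> real) \<Rightarrow> (nat \<Rightarrow> real) \<Rightarrow> nat \<Rightarrow> real" where
  "upperA n p x i = (\<Sum>j\<in>{i<..n}. p j * (x j - x i))"

definition lowerC :: "(nat \<Rightarrow> real) \<Rightarrow> (nat \<Rightarrow> real) \<Rightarrow> nat \<Rightarrow> real" where
  "lowerC p x i = (\<Sum>j\<in>{1..<i}. p j * (x i - x j))"

definition signalR :: "nat \<Rightarrow> (nat \<Rightarrow> real) \<Rightarrow> (nat \<Rightarrow> real) \<Rightarrow> nat \<Rightarrow> real" where
  "signalR n p x i =
     (if i < n then upperA n p x i / sqrt (tailT n p i * tailT n p (i + 1)) else 0)"

definition signalL :: "(nat \<Rightarrow> real) \<Rightarrow> (nat \<Rightarrow> real) \<Rightarrow> nat \<Rightarrow> real" where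
  "signalL p x i =
     (if 1 < i then lowerC p x i / sqrt (cumP p (i - 1) * cumP p i) else 0)"

definition signalD :: "nat \<Rightarrow> (nat \<Rightarrow> real) \<Rightarrow> (nat \<Rightarrow> real) \<Rightarrow> nat \<Rightarrow> real" where
  "signalD n p x i = (signalR n p x i)\<^sup>2 - (signalL p x i)\<^sup>2"

lemma weighted_square_minimal:
  fixes p x :: "nat \<Rightarrow> real"
  assumes "(\<Sum>j\<in>J. p j) > 0"
  defines "m \<equiv> (\<Sum>j\<in>J. p j * x j) / (\<Sum>j\<in>J. p j)"
  shows "(\<Sum>j\<in>J. p j * (x j - m)\<^sup>2) \<le> (\<Sum>j\<in>J. p j * (x j - a)\<^sup>2)"
proof -
  let ?s = "\<Sum>j\<in>J. p j"
  have ms: "(\<Sum>j\<in>J. p j * x j) = m * ?s"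
    using assms by simp
  have expand: "(\<Sum>j\<in>J. p j * (x j - c)\<^sup>2) =
      (\<Sum>j\<in>J. p j * (x j)\<^sup>2) - 2 * c * (\<Sum>j\<in>J. p j * x j) + c\<^sup>2 * ?s" for c
    by (simp add: power2_eq_square algebra_simps sum.distrib sum_subtractf sum_distrib_left)
  have "(\<Sum>j\<in>J. p j * (x j - a)\<^sup>2) - (\<Sum>j\<in>J. p j * (x j - m)\<^sup>2) = ?s * (a - m)\<^sup>2"
    unfolding expand ms by (simp add: power2_eq_square algebra_simps)
  moreover have "?s * (a - m)\<^sup>2 \<ge> 0"
    using assms(1) by simp
  ultimately show ?thesis by linarith
qed

lemma optimal_risk_attained:
  assumes pos: "\<And>j. j \<in> {1..n} \<Longrightarrow> p j > 0" and i: "i \<in> {1..<n}"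
  shows "\<exists>a b. optimal_risk n p x i = split_risk n p x i a b"
    and "optimal_risk n p x i \<le> split_risk n p x i c d"
proof -
  have l: "(\<Sum>j=1..i. p j) > 0" and u: "(\<Sum>j\<in>{i<..n}. p j) > 0"
    using i by (auto intro!: sum_pos pos)
  obtain a b where le: "\<And>c d. split_risk n p x i a b \<le> split_risk n p x i c d"
    unfolding split_risk_def
    using weighted_square_minimal[OF l, of x] weighted_square_minimal[OF u, of x]
    by (meson add_mono)
  have eq: "optimal_risk n p x i = split_risk n p x i a b"
    unfolding optimal_risk_def using le by (intro Least_equality) auto
  show "\<exists>a b. optimal_risk n p x i = split_risk n p x i a b"
    using eq by blast
  show "optimal_risk n p x i \<le> split_risk n p x i c d"
    using eq le by simp
qed

end

theory Submission
  imports Defs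
begin

text \<open>
  Moving the atom \<open>x i\<close> from the right cell to the left one changes the optimized risk by
  \<open>W (i - 1) - W i = p i * D i\<close>: both risks exceed that of the three-cell partition
  \<open>{<i}\<close>, \<open>{i}\<close>, \<open>{>i}\<close>, by \<open>p i * (R i)\<^sup>2\<close> and \<open>p i * (L i)\<^sup>2\<close>. If \<open>x k\<close> is the mean and both
  tails have mass \<open>q\<close>, then \<open>A k = C k\<close> and both normalizations equal \<open>sqrt (q * (1 - q))\<close>,
  so \<open>D k = 0\<close>. A nonincreasing signal is thus nonnegative before \<open>k\<close> and nonpositive after it,
  and the risk falls until \<open>k - 1\<close> and rises from \<open>k\<close> on.
\<close>

section \<open>Optimized risk as a sum of within-cell scatters\<close>

text \<open>For a cell of nonzero mass this is the weighted sum of squared deviations from the cell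
  mean. The moment form contains no centre, so adding an atom only changes three sums.\<close>

definition scatter :: "(nat \<Rightarrow> real) \<Rightarrow> (nat \<Rightarrow> real) \<Rightarrow> nat set \<Rightarrow> real" where
  "scatter p x J = (\<Sum>j\<in>J. p j * (x j)\<^sup>2) - (\<Sum>j\<in>J. p j * x j)\<^sup>2 / (\<Sum>j\<in>J. p j)"

lemma scatter_eq:
  assumes "(\<Sum>j\<in>J. p j) \<noteq> 0"
  shows "(\<Sum>j\<in>J. p j * (x j - (\<Sum>j\<in>J. p j * x j) / (\<Sum>j\<in>J. p j))\<^sup>2) = scatter p x J"
proof -
  have expand: "(\<Sum>j\<in>J. p j * (x j - c)\<^sup>2) =
      (\<Sum>j\<in>J. p j * (x j)\<^sup>2) - 2 * c * (\<Sum>j\<in>J. p j * x j) + c\<^sup>2 * (\<Sum>j\<in>J. p j)" for c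
    by (simp add: power2_eq_square algebra_simps sum.distrib sum_subtractf sum_distrib_left)
  show ?thesis
    unfolding expand scatter_def using assms by (simp add: power2_eq_square)
qed

lemma scatter_le:
  assumes "(\<Sum>j\<in>J. p j) > 0"
  shows "scatter p x J \<le> (\<Sum>j\<in>J. p j * (x j - a)\<^sup>2)"
  using weighted_square_minimal[OF assms, of x a] scatter_eq[of p J x] assms by simp

text \<open>This is the update formula for merging a point with a cell of mass \<open>w\<close> and
  mean \<open>m\<close>: the scatter grows by \<open>p i * w / (p i + w) * (m - x i)^2\<close>. The
  inner sum here equals \<open>w * (m - x i)\<close>, and writing the increment through it yields
  the shape of the squared signals.\<close>

lemma scatter_insert:
  assumes "finite J" "i \<notin> J" "(\<Sum>j\<in>J. p j) > 0" "p i > 0"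
  shows "scatter p x (insert i J) = scatter p x J +
    p i * ((\<Sum>j\<in>J. p j * (x j - x i))\<^sup>2 / ((\<Sum>j\<in>J. p j) * (p i + (\<Sum>j\<in>J. p j))))"
proof -
  define w s where "w = (\<Sum>j\<in>J. p j)" and "s = (\<Sum>j\<in>J. p j * x j)"
  have w: "w > 0" "p i + w > 0"
    using assms by (auto simp: w_def)
  have "(\<Sum>j\<in>J. p j * (x j - x i)) = s - x i * w"
    by (simp add: s_def w_def algebra_simps sum_subtractf sum_distrib_left)
  moreover have "p i * (x i)\<^sup>2 - (p i * x i + s)\<^sup>2 / (p i + w) =
      - (s\<^sup>2 / w) + p i * ((s - x i * w)\<^sup>2 / (w * (p i + w)))"
    using w by (simp add: divide_simps) (simp add: power2_eq_square algebra_simps)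
  ultimately show ?thesis
    using assms by (simp add: scatter_def flip: s_def w_def)
qed

text \<open>The constants \<open>a\<close> and \<open>b\<close> act on disjoint cells, so the two
  sums are minimized independently, each at its own cell mean.\<close>

lemma optimal_risk_eq_scatter:
  assumes "\<And>j. j \<in> {1..n} \<Longrightarrow> p j > 0" and "i \<in> {1..<n}"
  shows "optimal_risk n p x i = scatter p x {1..i} + scatter p x {i<..n}"
proof -
  have pos: "(\<Sum>j=1..i. p j) > 0" "(\<Sum>j\<in>{i<..n}. p j) > 0"
    using assms by (auto intro!: sum_pos)
  show ?thesis
    unfolding optimal_risk_def
  proof (rule Least_equality)
    have "scatter p x {1..i} + scatter p x {i<..n} = split_risk n p x i
        ((\<Sum>j=1..i. p j * x j) / (\<Sum>j=1..i. p j))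
        ((\<Sum>j\<in>{i<..n}. p j * x j) / (\<Sum>j\<in>{i<..n}. p j))"
      using pos by (simp add: split_risk_def scatter_eq)
    then show "\<exists>a b. scatter p x {1..i} + scatter p x {i<..n} = split_risk n p x i a b"
      by blast
    show "scatter p x {1..i} + scatter p x {i<..n} \<le> w"
      if "\<exists>a b. w = split_risk n p x i a b" for w
      using that pos by (auto simp: split_risk_def intro!: add_mono scatter_le)
  qed
qed

lemma optimal_risk_step:
  assumes pos: "\<And>j. j \<in> {1..n} \<Longrightarrow> p j > 0" and i: "1 < i" "i < n"
  shows "optimal_risk n p x (i - 1) - optimal_risk n p x i = p i * signalD n p x i"
proof -
  define wl where "wl = (\<Sum>j\<in>{1..<i}. p j)"
  define wr where "wr = (\<Sum>j\<in>{i<..n}. p j)"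
  have w: "wl > 0" "wr > 0" "p i > 0"
    using pos i by (auto simp: wl_def wr_def intro!: sum_pos)
  \<comment> \<open>The atom \<open>i\<close> lies in the right cell of the cut after
    \<open>i - 1\<close> and in the left cell of the cut after \<open>i\<close>. In this form
    \<open>scatter_insert\<close> applies on both sides.\<close>
  have ivl: "{1..i} = insert i {1..<i}" "{i - 1<..n} = insert i {i<..n}" "{1..i - 1} = {1..<i}"
    "{i..n} = insert i {i<..n}" "{i + 1..n} = {i<..n}"
    using i by auto
  have "(signalR n p x i)\<^sup>2 = (upperA n p x i)\<^sup>2 / (wr * (p i + wr))"
    unfolding signalR_def tailT_def ivl using i w
    by (simp add: power_divide wr_def[symmetric] mult.commute)
  then have r: "scatter p x {i - 1<..n} = scatter p x {i<..n} + p i * (signalR n p x i)\<^sup>2"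
    unfolding ivl using scatter_insert[of "{i<..n}" i p x] w by (simp add: upperA_def wr_def)
  \<comment> \<open>The sign is opposite to that of the sum in \<open>scatter_insert\<close>, which
    is harmless since only the square enters.\<close>
  have "lowerC p x i = - (\<Sum>j\<in>{1..<i}. p j * (x j - x i))"
    by (simp add: lowerC_def algebra_simps flip: sum_negf)
  moreover have "(signalL p x i)\<^sup>2 = (lowerC p x i)\<^sup>2 / (wl * (p i + wl))"
    unfolding signalL_def cumP_def ivl using i w
    by (simp add: power_divide wl_def[symmetric] mult.commute del: One_nat_def)
  ultimately have l: "scatter p x {1..i} = scatter p x {1..i - 1} + p i * (signalL p x i)\<^sup>2"
    unfolding ivl using scatter_insert[of "{1..<i}" i p x] w by (simp add: wl_def)
  have ii: "i - 1 \<in> {1..<n}" "i \<in> {1..<n}"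
    using i by auto
  have risks: "optimal_risk n p x (i - 1) = scatter p x {1..i - 1} + scatter p x {i - 1<..n}"
    "optimal_risk n p x i = scatter p x {1..i} + scatter p x {i<..n}"
    by (rule optimal_risk_eq_scatter, erule pos, rule ii)+
  show ?thesis
    unfolding risks r l signalD_def by (simp add: right_diff_distrib)
qed

section \<open>From the random variable to finite sums\<close>

lemma finite_lawD:
  assumes "finite_law M X n p x"
  shows "prob_space M" "X \<in> borel_measurable M" "strict_mono_on {1..n} x"
    and "(\<Sum>i=1..n. p i) = 1"
  using assms unfolding finite_law_def by - (elim conjE, assumption)+

lemma finite_law_weight:
  assumes "finite_law M X n p x" "i \<in> {1..n}"
  shows "measure M {\<omega> \<in> space M. X \<omega> = x i} = p i" "p i > 0"
  using assms unfolding finite_law_def by metis+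

text \<open>The events at the atoms are disjoint because \<open>x\<close> is injective, and their
  masses add up to 1, so nothing is left for other values.\<close>

lemma finite_law_AE:
  assumes "finite_law M X n p x"
  shows "AE \<omega> in M. X \<omega> \<in> x ` {1..n}"
proof -
  interpret prob_space M
    using assms by (rule finite_lawD)
  have [measurable]: "X \<in> borel_measurable M"
    using assms by (rule finite_lawD)
  have inj: "inj_on x {1..n}"
    using finite_lawD(3)[OF assms] by (rule strict_mono_on_imp_inj_on)
  have "prob (\<Union>i\<in>{1..n}. {\<omega> \<in> space M. X \<omega> = x i}) =
      (\<Sum>i=1..n. prob {\<omega> \<in> space M. X \<omega> = x i})"
  proof (rule finite_measure_finite_Union)
    show "disjoint_family_on (\<lambda>i. {\<omega> \<in> space M. X \<omega> = x i}) {1..n}"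
      unfolding disjoint_family_on_def using inj_onD[OF inj] by fastforce
    show "(\<lambda>i. {\<omega> \<in> space M. X \<omega> = x i}) ` {1..n} \<subseteq> events"
      by (intro image_subsetI) measurable
  qed simp
  also have "\<dots> = 1"
    using finite_lawD(4)[OF assms] finite_law_weight(1)[OF assms] by simp
  finally have "AE \<omega> in M. \<omega> \<in> (\<Union>i\<in>{1..n}. {\<omega> \<in> space M. X \<omega> = x i})"
    by (intro AE_prob_1)
  then show ?thesis
    by eventually_elim auto
qed

text \<open>Almost everywhere \<open>g (X \<omega>)\<close> agrees with a finite combination of
  indicators, so no separate integrability assumption on \<open>g\<close> is required.\<close>

lemma finite_law_expectation:
  fixes g :: "real \<Rightarrow> real"
  assumes law: "finite_law M X n p x" and [measurable]: "g \<in> borel_measurable borel"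
  shows "prob_space.expectation M (\<lambda>\<omega>. g (X \<omega>)) = (\<Sum>j=1..n. p j * g (x j))"
proof -
  interpret prob_space M
    using law by (rule finite_lawD)
  have [measurable]: "X \<in> borel_measurable M"
    using law by (rule finite_lawD)
  have inj: "inj_on x {1..n}"
    using finite_lawD(3)[OF law] by (rule strict_mono_on_imp_inj_on)
  let ?E = "\<lambda>j. {\<omega> \<in> space M. X \<omega> = x j}"
  have "expectation (\<lambda>\<omega>. g (X \<omega>)) = expectation (\<lambda>\<omega>. \<Sum>j=1..n. g (x j) * indicator (?E j) \<omega>)"
  proof (rule integral_cong_AE)
    show "AE \<omega> in M. g (X \<omega>) = (\<Sum>j=1..n. g (x j) * indicator (?E j) \<omega>)"
      using finite_law_AE[OF law] AE_space
    proof eventually_elim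
      case (elim \<omega>)
      then obtain i where i: "i \<in> {1..n}" "X \<omega> = x i"
        by auto
      \<comment> \<open>Injectivity of \<open>x\<close> leaves exactly one nonzero summand at each
        such point.\<close>
      have "g (x j) * indicator (?E j) \<omega> = (if j = i then g (x i) else 0)" if "j \<in> {1..n}" for j
        using inj_on_eq_iff[OF inj i(1) that] elim(2) i(2) by (cases "j = i") simp_all
      then have "(\<Sum>j=1..n. g (x j) * indicator (?E j) \<omega>) = (\<Sum>j=1..n. if j = i then g (x i) else 0)"
        by (rule sum.cong[OF refl])
      then show ?case
        using i by simp
    qed
  qed measurable
  also have "\<dots> = (\<Sum>j=1..n. expectation (\<lambda>\<omega>. g (x j) * indicator (?E j) \<omega>))"
    by (intro Bochner_Integration.integral_sum integrable_mult_right integrable_real_indicator)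
      (measurable, simp add: emeasure_eq_measure)
  also have "\<dots> = (\<Sum>j=1..n. g (x j) * prob (?E j))"
    by (intro sum.cong) (simp_all add: Int_absorb2)
  also have "\<dots> = (\<Sum>j=1..n. p j * g (x j))"
    using finite_law_weight(1)[OF law] by (intro sum.cong) auto
  finally show ?thesis .
qed

text \<open>A probability is the expectation of an indicator; this turns the two tail hypotheses
  into sums of weights.\<close>

lemma finite_law_prob:
  assumes law: "finite_law M X n p x" and "S \<in> sets borel"
  shows "measure M {\<omega> \<in> space M. X \<omega> \<in> S} = (\<Sum>j\<in>{j\<in>{1..n}. x j \<in> S}. p j)"
proof -
  interpret prob_space M
    using law by (rule finite_lawD)
  have [measurable]: "X \<in> borel_measurable M" "S \<in> sets borel"
    using finite_lawD(2)[OF law] assms(2) by blast+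
  have "measure M {\<omega> \<in> space M. X \<omega> \<in> S} = expectation (indicator {\<omega> \<in> space M. X \<omega> \<in> S})"
    by simp
  also have "\<dots> = expectation (\<lambda>\<omega>. indicator S (X \<omega>))"
    by (intro Bochner_Integration.integral_cong) (auto simp: indicator_def)
  also have "\<dots> = (\<Sum>j=1..n. p j * indicator S (x j))"
    using assms(2) by (intro finite_law_expectation[OF law]) auto
  also have "\<dots> = (\<Sum>j\<in>{j\<in>{1..n}. x j \<in> S}. p j)"
    by (rule sum.mono_neutral_cong_right) auto
  finally show ?thesis .
qed

section \<open>The signal at a balanced mean and the optimal cuts\<close>

lemma signalD_balanced:
  assumes k: "k \<in> {1..n}" and total: "(\<Sum>j=1..n. p j) = 1"
    and mean: "(\<Sum>j=1..n. p j * x j) = x k"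
    and below: "(\<Sum>j\<in>{1..<k}. p j) = q" and above: "(\<Sum>j\<in>{k<..n}. p j) = q"
    and q: "q > 0"
  shows "signalD n p x k = 0"
proof -
  \<comment> \<open>Both tails have positive mass, hence are nonempty; so \<open>k\<close> is not an
    endpoint and neither default value 0 of the signals is used.\<close>
  have kn: "1 < k" "k < n"
    using k below above q by (fastforce intro: ccontr)+
  have ivl: "{1..n} = insert k ({1..<k} \<union> {k<..n})" "{1..k} = insert k {1..<k}"
    "{1..k - 1} = {1..<k}" "{k..n} = insert k {k<..n}" "{k + 1..n} = {k<..n}"
    using kn by auto
  have split: "(\<Sum>j=1..n. f j) = f k + (\<Sum>j\<in>{1..<k}. f j) + (\<Sum>j\<in>{k<..n}. f j)"
    for f :: "nat \<Rightarrow> real"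
    unfolding ivl(1) by (subst sum.insert; (subst sum.union_disjoint)?) auto
  have pk: "p k = 1 - 2 * q"
    using total split[of p] below above by simp
  \<comment> \<open>The difference is the first moment about \<open>x k\<close>, which vanishes
    because \<open>x k\<close> is the mean.\<close>
  have "upperA n p x k - lowerC p x k = (\<Sum>j=1..n. p j * (x j - x k))"
    unfolding split upperA_def lowerC_def by (simp add: algebra_simps sum_subtractf)
  also have "\<dots> = (\<Sum>j=1..n. p j * x j) - (\<Sum>j=1..n. p j) * x k"
    by (simp add: right_diff_distrib sum_subtractf sum_distrib_right)
  finally have "upperA n p x k = lowerC p x k"
    using total mean by simp
  moreover have "tailT n p k * tailT n p (k + 1) = cumP p (k - 1) * cumP p k"
    unfolding tailT_def cumP_def ivl by (simp add: below above pk del: One_nat_def)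
  ultimately show ?thesis
    using kn by (simp add: signalD_def signalR_def signalL_def)
qed

lemma globally_optimal_cut_iff:
  "globally_optimal_cut n p x i \<longleftrightarrow>
    i \<in> {1..<n} \<and> (\<forall>j\<in>{1..<n}. optimal_risk n p x i \<le> optimal_risk n p x j)"
  unfolding globally_optimal_cut_def by (auto simp: Min_eq_iff eq_commute[of _ "Min _"])

theorem corollary4p1:
  fixes M :: "'a measure" and X :: "'a \<Rightarrow> real"
    and p x :: "nat \<Rightarrow> real" and n k :: nat and \<mu> q :: real
  assumes "n \<ge> 2"
    and "finite_law M X n p x"
    and "\<mu> = prob_space.expectation M X"
    and "k \<in> {1..n}" and "\<mu> = x k"
    and "measure M {\<omega> \<in> space M. X \<omega> < \<mu>} = q"
    and "measure M {\<omega> \<in> space M. X \<omega> > \<mu>} = q"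
    and "q > 0"
  shows "k - 1 \<in> {1..<n} \<and> k \<in> {1..<n} \<and>
    gain M X n p x (k - 1) = gain M X n p x k \<and>
    (antimono_on {1..n} (signalD n p x) \<longrightarrow>
       globally_optimal_cut n p x (k - 1) \<and> globally_optimal_cut n p x k) \<and>
    (strict_antimono_on {1..n} (signalD n p x) \<longrightarrow>
       {i. globally_optimal_cut n p x i} = {k - 1, k})"
proof -
  let ?W = "optimal_risk n p x" and ?D = "signalD n p x"
  have mono: "strict_mono_on {1..n} x" and pos: "\<And>j. j \<in> {1..n} \<Longrightarrow> p j > 0"
    and total: "(\<Sum>j=1..n. p j) = 1"
    using finite_lawD(3,4)[OF assms(2)] finite_law_weight(2)[OF assms(2)] by auto
  \<comment> \<open>Strict monotonicity turns the tail events at the mean into index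
    intervals.\<close>
  have "{j \<in> {1..n}. x j < x k} = {1..<k}" "{j \<in> {1..n}. x j > x k} = {k<..n}"
    using assms(4) strict_mono_on_less[OF mono] by auto
  then have below: "(\<Sum>j\<in>{1..<k}. p j) = q" and above: "(\<Sum>j\<in>{k<..n}. p j) = q"
    using finite_law_prob[OF assms(2), of "{..<\<mu>}"] finite_law_prob[OF assms(2), of "{\<mu><..}"]
      assms(5-7) by auto
  have mean: "(\<Sum>j=1..n. p j * x j) = x k"
    using finite_law_expectation[OF assms(2), of "\<lambda>y. y"] assms(3,5) by simp
  have k: "1 < k" "k < n"
    using assms(4,8) below above by (fastforce intro: ccontr)+
  have Dk: "?D k = 0"
    using signalD_balanced[OF assms(4) total mean below above assms(8)] .
  have diff: "?W (i - 1) - ?W i = p i * ?D i" if "1 < i" "i < n" for i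
    using optimal_risk_step[of n p i x] pos that by blast
  \<comment> \<open>The two cuts differ only by the side on which the mean atom lies, and moving it
    costs \<open>p k * ?D k = 0\<close>.\<close>
  have Weq: "?W (k - 1) = ?W k"
    using diff[OF k] Dk by simp
  have optimal: "?W k \<le> ?W j" if anti: "antimono_on {1..n} ?D" and j: "j \<in> {1..<n}" for j
  proof (cases "j < k")
    case True
    then have "j \<le> k - 1" by simp
    then have "?W (k - 1) \<le> ?W j"
    \<comment> \<open>The induction runs downward from \<open>k - 1\<close> to \<open>j\<close>.
      Passing from \<open>Suc i\<close> to \<open>i\<close> involves the signal at
      \<open>Suc i\<close>, which is still below \<open>k\<close>.\<close>
    proof (rule inc_induct)
      fix i assume i: "j \<le> i" "i < k - 1" and IH: "?W (k - 1) \<le> ?W (Suc i)"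
      have Si: "1 < Suc i" "Suc i < n"
        using i j k by auto
      have "?D (Suc i) \<ge> 0"
        using monotone_onD[OF anti, of "Suc i" k] i k Dk by auto
      then have "p (Suc i) * ?D (Suc i) \<ge> 0"
        using pos[of "Suc i"] Si by simp
      then show "?W (k - 1) \<le> ?W i"
        using diff[OF Si] IH by simp
    qed simp
    then show ?thesis using Weq by simp
  next
    case False
    then have "k \<le> j" by simp
    then show ?thesis
    proof (rule dec_induct)
      fix i assume i: "k \<le> i" "i < j" and IH: "?W k \<le> ?W i"
      have "?D (Suc i) \<le> 0"
        using monotone_onD[OF anti, of k "Suc i"] i j k Dk by auto
      then have "p (Suc i) * ?D (Suc i) \<le> 0"
        using pos[of "Suc i"] i j by (simp add: mult_le_0_iff)
      then show "?W k \<le> ?W (Suc i)"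
        using diff[of "Suc i"] IH i j k by simp
    qed simp
  qed
  have antimono: "antimono_on {1..n} ?D" if "strict_antimono_on {1..n} ?D"
    using that unfolding monotone_on_def by (metis order_le_less)
  \<comment> \<open>One strict step from \<open>j\<close> towards the pair suffices; the neighbour
    reached is already at least \<open>?W k\<close> by \<open>optimal\<close>. Excluding
    \<open>k - 1\<close> and \<open>k\<close> ensures that the signal of this step is taken at an
    index other than \<open>k\<close>, where it is nonzero.\<close>
  have strict: "?W k < ?W j"
    if anti: "strict_antimono_on {1..n} ?D" and j: "j \<in> {1..<n}" "j \<noteq> k - 1" "j \<noteq> k" for j
  proof (cases "j < k")
    case True
    then have j': "Suc j < k" using j by simp
    then have "?D (Suc j) > 0"
      using monotone_onD[OF anti, of "Suc j" k] k Dk by auto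
    then have "p (Suc j) * ?D (Suc j) > 0"
      using pos[of "Suc j"] j' k by simp
    moreover have "?W k \<le> ?W (Suc j)"
      using optimal[OF antimono[OF anti], of "Suc j"] j' k by simp
    ultimately show ?thesis
      using diff[of "Suc j"] j j' k by simp
  next
    case False
    then have j': "k < j" using j by simp
    then have "?D j < 0"
      using monotone_onD[OF anti, of k j] j k Dk by auto
    then have "p j * ?D j < 0"
      using pos[of j] j by (simp add: mult_less_0_iff)
    moreover have "j - 1 \<in> {1..<n}"
      using j j' k by auto
    then have "?W k \<le> ?W (j - 1)"
      by (rule optimal[OF antimono[OF anti]])
    ultimately show ?thesis
      using diff[of j] j j' k by simp
  qed
  have "{i. globally_optimal_cut n p x i} = {k - 1, k}" if anti: "strict_antimono_on {1..n} ?D"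
  proof -
    have "globally_optimal_cut n p x k"
      using optimal[OF antimono[OF anti]] k
      by (simp add: globally_optimal_cut_iff)
    moreover have "globally_optimal_cut n p x (k - 1)"
      using calculation k Weq by (auto simp: globally_optimal_cut_iff)
    moreover have "i \<in> {k - 1, k}" if "globally_optimal_cut n p x i" for i
    proof (rule ccontr)
      assume "i \<notin> {k - 1, k}"
      moreover have "i \<in> {1..<n}" "?W i \<le> ?W k"
        using that k by (auto simp: globally_optimal_cut_iff)
      ultimately show False
        using strict[OF anti, of i] by simp
    qed
    ultimately show ?thesis by blast
  qed
  then show ?thesis
    using k Weq optimal by (auto simp: gain_def globally_optimal_cut_iff)
qed

end
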